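(* Fix an integer $k\ge 5$. Suppose that $r(k,n)=\Theta_k\big(n^{k-1}/(\log n)^{k-2}\big)$, i.e. there are constants $b_1,b_2>0$ (depending only on $k$) such that $b_1 n^{k-1}/(\log n)^{k-2}\le r(k,n)\le b_2 n^{k-1}/(\log n)^{k-2}$ for all sufficiently large $n$. Then there exist constants $a_1,a_2>0$ (depending only on $k$ and $b_1,b_2$) such that for all integers $n\ge 2$ and $N\ge 1$: (i) if $N\le a_1 n^{k-1}/(\log n)^{k-2}$, then $f(N,k,n)=0$; and (ii) if $N\ge a_1 n^{k-1}/(\log n)^{k-2}$, then $$f(N,k,n)\le a_2\binom{N}{k}\Big(\frac{\log n}{n}\Big)^{\binom{k}{2}}\cdot\frac{1}{\log n}.$$
   Context: Graphs are finite and simple. $r(k,n)$ is the off-diagonal Ramsey number: the least $N$ such that every $N$-vertex graph contains a clique of size $k$ or an independent set of size $n$. $f(N,k,n)$ denotes the minimum number of (unlabeled) cliques of size $k$ in an $N$-vertex graph with no independent set of size $n$. $\log$ is the natural logarithm. *)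

theory Defs
  imports Complex_Main "HOL-Library.Ramsey"
begin

definition finite_simple_graph :: "'a set \<Rightarrow> 'a set set \<Rightarrow> bool" where
  "finite_simple_graph V E \<longleftrightarrow> finite V \<and> E \<subseteq> [V]\<^bsup>2\<^esup>"

definition k_cliques :: "nat \<Rightarrow> 'a set \<Rightarrow> 'a set set \<Rightarrow> 'a set set" where
  "k_cliques k V E = {K \<in> [V]\<^bsup>k\<^esup>. clique K E}"

definition k_indep_sets :: "nat \<Rightarrow> 'a set \<Rightarrow> 'a set set \<Rightarrow> 'a set set" where
  "k_indep_sets k V E = {I \<in> [V]\<^bsup>k\<^esup>. indep I E}"

(* Up to isomorphism every finite graph has its vertices in nat, so both
   quantities below range over graphs with vertex type nat. *)

definition ramsey_number :: "nat \<Rightarrow> nat \<Rightarrow> nat" where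
  "ramsey_number k n = (LEAST N. \<forall>(V :: nat set) E.
     finite_simple_graph V E \<and> card V = N \<longrightarrow> k_cliques k V E \<noteq> {} \<or> k_indep_sets n V E \<noteq> {})"

(* For n >= 2 the complete graph shows that the minimum is over a nonempty set. *)
definition min_k_cliques :: "nat \<Rightarrow> nat \<Rightarrow> nat \<Rightarrow> nat" where
  "min_k_cliques N k n = (LEAST c. \<exists>(V :: nat set) E.
     finite_simple_graph V E \<and> card V = N \<and> k_indep_sets n V E = {} \<and> card (k_cliques k V E) = c)"

lemma ramsey_number_works:
  fixes V :: "nat set"
  assumes "finite_simple_graph V E" "card V = ramsey_number k n"
  shows "k_cliques k V E \<noteq> {} \<or> k_indep_sets n V E \<noteq> {}"
proof -
  let ?P = "\<lambda>N. \<forall>(V :: nat set) E. finite_simple_graph V E \<and> card V = N \<longrightarrow>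
     k_cliques k V E \<noteq> {} \<or> k_indep_sets n V E \<noteq> {}"
  obtain r where r: "\<forall>(V :: nat set) E. finite V \<and> card V \<ge> r \<longrightarrow>
      (\<exists>R \<subseteq> V. card R = k \<and> clique R E \<or> card R = n \<and> indep R E)"
    using ramsey2[of k n] by blast
  have "?P r"
  proof (intro allI impI)
    fix V :: "nat set" and E
    assume G: "finite_simple_graph V E \<and> card V = r"
    then obtain R where "R \<subseteq> V" "finite R" "card R = k \<and> clique R E \<or> card R = n \<and> indep R E"
      using r unfolding finite_simple_graph_def by (metis le_refl finite_subset)
    then show "k_cliques k V E \<noteq> {} \<or> k_indep_sets n V E \<noteq> {}"
      unfolding k_cliques_def k_indep_sets_def nsets_def by blast
  qed
  then have "?P (ramsey_number k n)"
    unfolding ramsey_number_def by (rule LeastI)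
  then show ?thesis using assms by blast
qed

lemma min_k_cliques_attained:
  assumes "n \<ge> 2"
  shows "\<exists>(V :: nat set) E. finite_simple_graph V E \<and> card V = N \<and> k_indep_sets n V E = {}
    \<and> card (k_cliques k V E) = min_k_cliques N k n"
proof -
  have "finite_simple_graph {..<N} ([{..<N}]\<^bsup>2\<^esup>)"
    by (simp add: finite_simple_graph_def)
  moreover have "k_indep_sets n {..<N} ([{..<N}]\<^bsup>2\<^esup>) = {}"
  proof (rule ccontr)
    assume "k_indep_sets n {..<N} ([{..<N}]\<^bsup>2\<^esup>) \<noteq> {}"
    then obtain I where I: "I \<subseteq> {..<N}" "card I = n" "indep I ([{..<N}]\<^bsup>2\<^esup>)"
      by (auto simp: k_indep_sets_def nsets_def)
    with assms obtain x y where "x \<in> I" "y \<in> I" "x \<noteq> y"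
      by (metis card_le_Suc0_iff_eq card.infinite not_less_eq_eq numeral_2_eq_2 not_numeral_le_zero)
    with I show False by (auto simp: indep_def)
  qed
  ultimately have "\<exists>c. \<exists>(V :: nat set) E. finite_simple_graph V E \<and> card V = N
      \<and> k_indep_sets n V E = {} \<and> card (k_cliques k V E) = c"
    by (metis card_lessThan)
  then show ?thesis unfolding min_k_cliques_def by (rule LeastI_ex)
qed

end

theory Submission
  imports Defs
begin

text \<open>Blow up an extremal graph G for r(k,n), on r(k,n) - 1 vertices, by replacing its vertices with
  cliques of nearly equal sizes on N vertices altogether. No independent n-set arises, and a
  k-clique of the blow-up projects to a clique of G with j < k vertices. To count these, note that
  the common neighbourhood of an i-clique contains no (k-i)-clique and no independent n-set, so
  that it has O(n^(k-i-1) / (ln n)^(k-i-2)) vertices by the theorem of Ajtai, Komlos and Szemeredi;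
  the product of these bounds over i < k - 1 is of order (ln n)^(k-1) (n / ln n)^(k choose 2).

  The Ajtai--Komlos--Szemeredi bound follows by induction on the clique size from a bound for
  graphs of maximum degree d in which any two adjacent vertices have at most t common neighbours:
  the independence number is at least |V| ln (d/t) / (24 d). This is proved as in the
  triangle-free case, except that the uniform random independent set is replaced
  by the hard-core model, where I has weight proportional to l ^ card I, with fugacity l = 1 / t.\<close>

section \<open>The hard-core model and independent sets in locally sparse graphs\<close>

text \<open>\<open>E\<close> is an arbitrary set of sets and is not cut down to \<open>V\<close>, so
  the same \<open>E\<close> serves every induced subgraph; \<open>u \<noteq> v\<close> guards
  against singletons in \<open>E\<close>.\<close>

definition nbrs :: "'a set \<Rightarrow> 'a set set \<Rightarrow> 'a \<Rightarrow> 'a set" where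
  "nbrs V E v = {u \<in> V. u \<noteq> v \<and> {v, u} \<in> E}"

definition indsets :: "'a set \<Rightarrow> 'a set set \<Rightarrow> 'a set set" where
  "indsets V E = {I. I \<subseteq> V \<and> indep I E}"

text \<open>The partition function of the hard-core model. Averages stay unnormalised: the expected
  size of the random set is \<open>hc_size\<close> divided by \<open>hc_weight\<close>.\<close>

definition hc_weight :: "real \<Rightarrow> 'a set \<Rightarrow> 'a set set \<Rightarrow> real" where
  "hc_weight l V E = (\<Sum>I\<in>indsets V E. l ^ card I)"

definition hc_size :: "real \<Rightarrow> 'a set \<Rightarrow> 'a set set \<Rightarrow> real" where
  "hc_size l V E = (\<Sum>I\<in>indsets V E. real (card I) * l ^ card I)"

lemma finite_nbrs: "finite V \<Longrightarrow> finite (nbrs V E v)"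
  by (simp add: nbrs_def)

lemma in_nbrs_commute: "u \<in> V \<Longrightarrow> v \<in> V \<Longrightarrow> u \<in> nbrs V E v \<longleftrightarrow> v \<in> nbrs V E u"
  by (auto simp: nbrs_def insert_commute)

lemma finite_indsets: "finite V \<Longrightarrow> finite (indsets V E)"
  by (rule finite_subset[of _ "Pow V"]) (auto simp: indsets_def)

lemma empty_in_indsets: "{} \<in> indsets V E"
  by (simp add: indsets_def indep_def)

lemma indsets_subset: "I \<in> indsets V E \<Longrightarrow> J \<subseteq> I \<Longrightarrow> J \<in> indsets V E"
  by (auto simp: indsets_def indep_def)

lemma finite_indset: "finite V \<Longrightarrow> I \<in> indsets V E \<Longrightarrow> finite I"
  by (auto simp: indsets_def intro: finite_subset)

lemma insert_in_indsets_iff: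
  assumes "I \<in> indsets V E" "u \<in> V"
  shows "insert u I \<in> indsets V E \<longleftrightarrow> (\<forall>i\<in>I. u \<notin> nbrs V E i)"
  using assms by (auto simp: indsets_def indep_def nbrs_def insert_commute)

lemma hc_weight_ge_1:
  fixes V :: "'a set"
  assumes "finite V" "l \<ge> 0"
  shows "hc_weight l V E \<ge> 1"
proof -
  have "(\<Sum>I\<in>{{} :: 'a set}. l ^ card I) \<le> hc_weight l V E"
    unfolding hc_weight_def using assms
    by (intro sum_mono2) (auto simp: finite_indsets empty_in_indsets)
  then show ?thesis by simp
qed

text \<open>Dropping independence leaves the sum over all subsets, which is
  \<open>(1 + l) ^ card V\<close>.\<close>

lemma hc_weight_le_exp:
  assumes "finite V" "l \<ge> 0"
  shows "hc_weight l V E \<le> exp (l * real (card V))"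
proof -
  have "hc_weight l V E \<le> (\<Sum>I\<in>Pow V. l ^ card I)"
    unfolding hc_weight_def using assms
    by (intro sum_mono2) (auto simp: indsets_def)
  also have "\<dots> = (\<Prod>v\<in>V. l + 1)"
    by (subst prod_add[OF assms(1)]) simp
  also have "\<dots> = (1 + l) ^ card V"
    by (simp add: add.commute)
  also have "\<dots> \<le> exp l ^ card V"
    using assms by (intro power_mono) auto
  finally show ?thesis
    by (simp add: exp_of_nat2_mult)
qed

text \<open>Deleting u matches the independent sets containing u with those that u can extend, at
  the cost of a factor l. An independent set I blocks at most (t + 1) card I vertices, namely its
  members and their neighbours; all others lie in \<open>F I\<close>.\<close>

lemma hc_size_ge:
  assumes V: "finite V" and l: "l \<ge> 0"
    and deg: "\<And>u. u \<in> V \<Longrightarrow> real (card (nbrs V E u)) \<le> t"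
  shows "l * real (card V) * hc_weight l V E \<le> (1 + l * (t + 1)) * hc_size l V E"
proof -
  define F where "F I = {u \<in> V. u \<notin> I \<and> insert u I \<in> indsets V E}" for I
  have extend: "(\<Sum>I\<in>{I \<in> indsets V E. u \<in> I}. l ^ card I)
      = l * (\<Sum>I\<in>{I \<in> indsets V E. u \<in> F I}. l ^ card I)" if "u \<in> V" for u
  proof -
    have "(\<Sum>I\<in>{I \<in> indsets V E. u \<in> I}. l ^ card I)
        = (\<Sum>I\<in>{I \<in> indsets V E. u \<in> F I}. l ^ card (insert u I))"
      by (rule sum.reindex_bij_witness[where i = "insert u" and j = "\<lambda>I. I - {u}"])
        (use that in \<open>auto simp: F_def insert_absorb intro: indsets_subset\<close>)
    also have "\<dots> = (\<Sum>I\<in>{I \<in> indsets V E. u \<in> F I}. l * l ^ card I)"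
      using finite_indset[OF V] by (intro sum.cong) (auto simp: F_def)
    finally show ?thesis by (simp add: sum_distrib_left)
  qed
  have F_card: "real (card (F I)) \<ge> real (card V) - (t + 1) * real (card I)"
    if I: "I \<in> indsets V E" for I
  proof -
    have fI: "finite I" and IV: "I \<subseteq> V"
      using I V finite_indset by (auto simp: indsets_def)
    have "V \<subseteq> F I \<union> (I \<union> (\<Union>i\<in>I. nbrs V E i))"
      using insert_in_indsets_iff[OF I] by (auto simp: F_def)
    moreover have "finite (F I \<union> (I \<union> (\<Union>i\<in>I. nbrs V E i)))"
      using fI V by (auto simp: F_def finite_nbrs)
    ultimately have "card V \<le> card (F I \<union> (I \<union> (\<Union>i\<in>I. nbrs V E i)))"
      by (rule card_mono[rotated])
    also have "\<dots> \<le> card (F I) + card (I \<union> (\<Union>i\<in>I. nbrs V E i))" by (rule card_Un_le)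
    also have "\<dots> \<le> card (F I) + (card I + card (\<Union>i\<in>I. nbrs V E i))"
      by (intro add_left_mono card_Un_le)
    also have "\<dots> \<le> card (F I) + (card I + (\<Sum>i\<in>I. card (nbrs V E i)))"
      by (intro add_left_mono card_UN_le fI)
    finally have "real (card V) \<le> real (card (F I)) + real (card I) + (\<Sum>i\<in>I. real (card (nbrs V E i)))"
      by (simp flip: of_nat_sum of_nat_add)
    also have "(\<Sum>i\<in>I. real (card (nbrs V E i))) \<le> (\<Sum>i\<in>I. t)"
      using IV by (intro sum_mono deg) auto
    finally show ?thesis by (simp add: algebra_simps)
  qed
  have "hc_size l V E = (\<Sum>I\<in>indsets V E. \<Sum>u\<in>{u \<in> V. u \<in> I}. l ^ card I)"
    unfolding hc_size_def
    by (intro sum.cong refl) (auto simp: indsets_def Int_absorb1 intro!: arg_cong[of _ _ card])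
  also have "\<dots> = (\<Sum>u\<in>V. \<Sum>I\<in>{I \<in> indsets V E. u \<in> I}. l ^ card I)"
    by (rule sum.swap_restrict[OF finite_indsets[OF V] V])
  also have "\<dots> = l * (\<Sum>u\<in>V. \<Sum>I\<in>{I \<in> indsets V E. u \<in> F I}. l ^ card I)"
    by (simp add: extend sum_distrib_left)
  also have "\<dots> = l * (\<Sum>I\<in>indsets V E. \<Sum>u\<in>{u \<in> V. u \<in> F I}. l ^ card I)"
    by (subst sum.swap_restrict[OF finite_indsets[OF V] V]) simp
  also have "\<dots> = l * (\<Sum>I\<in>indsets V E. real (card (F I)) * l ^ card I)"
    by (simp add: F_def)
  also have "\<dots> \<ge> l * (\<Sum>I\<in>indsets V E. (real (card V) - (t + 1) * real (card I)) * l ^ card I)"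
    using l by (intro mult_left_mono sum_mono mult_right_mono F_card) auto
  also have "(\<Sum>I\<in>indsets V E. (real (card V) - (t + 1) * real (card I)) * l ^ card I)
      = real (card V) * hc_weight l V E - (t + 1) * hc_size l V E"
    by (simp add: hc_weight_def hc_size_def algebra_simps sum_subtractf sum_distrib_left sum.distrib)
  finally show ?thesis by (simp add: algebra_simps)
qed

lemma ln_le_double_sqrt: "D > 0 \<Longrightarrow> ln D \<le> 2 * sqrt (D :: real)"
  using ln_le_minus_one[of "sqrt D"] by (simp add: ln_sqrt)

text \<open>V stands for the part of a neighbourhood left free by the rest of the independent set;
  the extra 1/t and d/t account for choosing the centre instead. Put y = card V / t and D = d / t.
  If y is at least ln D / 2, the expected size, at least y / 3, suffices. Otherwise the partition
  function is at most exp y, hence at most sqrt D, and the term D alone suffices.\<close>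

lemma hc_local_bound:
  assumes V: "finite V" and t: "t \<ge> 1" "t \<le> d"
    and deg: "\<And>u. u \<in> V \<Longrightarrow> real (card (nbrs V E u)) \<le> t"
  shows "(1 / t + hc_weight (1 / t) V E) * (ln (d / t) / 12) \<le> d / t + hc_size (1 / t) V E"
proof -
  define D where "D = d / t"
  define y where "y = real (card V) / t"
  define Z where "Z = hc_weight (1 / t) V E"
  define M where "M = hc_size (1 / t) V E"
  have D: "D \<ge> 1" using t by (simp add: D_def)
  have Z1: "Z \<ge> 1" unfolding Z_def using t V by (intro hc_weight_ge_1) auto
  have M0: "M \<ge> 0" unfolding M_def hc_size_def using t by (intro sum_nonneg) auto
  have "1 / t * real (card V) * Z \<le> (1 + 1 / t * (t + 1)) * M"
    unfolding Z_def M_def using t by (intro hc_size_ge V deg) auto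
  moreover have "(1 + 1 / t * (t + 1)) * M \<le> 3 * M"
    using t M0 by (intro mult_right_mono) (auto simp: field_simps)
  ultimately have M: "y * Z \<le> 3 * M" by (simp add: y_def)
  have inv_t: "1 / t \<le> 1" using t by simp
  have "(1 / t + Z) * (ln D / 12) \<le> 2 * Z * (ln D / 12)"
    using inv_t Z1 D by (intro mult_right_mono) auto
  also have "\<dots> \<le> D + M"
  proof (cases "y \<ge> ln D / 2")
    case True
    then have "ln D / 2 * Z \<le> y * Z" using Z1 by (intro mult_right_mono) auto
    with M show ?thesis using D by (simp add: mult.commute)
  next
    case False
    have "Z \<le> exp y"
      unfolding Z_def y_def using hc_weight_le_exp[OF V, of "1 / t" E] t by simp
    also have "\<dots> \<le> exp (ln (sqrt D))"
      using False D by (simp add: ln_sqrt)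
    finally have "Z \<le> sqrt D" using D by simp
    then have "2 * Z * (ln D / 12) \<le> 2 * sqrt D * (2 * sqrt D / 12)"
      using D Z1 ln_le_double_sqrt[of D] by (intro mult_mono) auto
    also have "\<dots> = D / 3" using D by simp
    finally show ?thesis using M0 D by simp
  qed
  finally show ?thesis by (simp add: D_def Z_def M_def)
qed

text \<open>Condition on the trace J of I outside v and its neighbourhood N(v): then either v is in I and
  N(v) is avoided, or I restricted to N(v) is a hard-core sample on the vertices of N(v)
  that see no vertex of J.\<close>
lemma hc_vertex_bound:
  assumes V: "finite V" and v: "v \<in> V" and t: "t \<ge> 1" "t \<le> d"
    and codeg: "\<And>u. u \<in> nbrs V E v \<Longrightarrow> real (card (nbrs (nbrs V E v) E u)) \<le> t"
  shows "ln (d / t) / 12 * hc_weight (1 / t) V E \<le>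
    (\<Sum>I\<in>indsets V E. (d * of_bool (v \<in> I) + real (card (I \<inter> nbrs V E v))) * (1 / t) ^ card I)"
proof -
  define N where "N = nbrs V E v"
  define L where "L = ln (d / t) / 12"
  define l where "l = 1 / t"
  \<comment> \<open>Subtracting \<open>L\<close> from the reward turns the claim into nonnegativity
    of the sum of \<open>g\<close>, which can be checked on each fibre of the trace
    \<open>J\<close>.\<close>
  define g where "g I = (d * of_bool (v \<in> I) + real (card (I \<inter> N)) - L) * l ^ card I" for I
  define W where "W = V - insert v N"
  have l: "l > 0" using t by (simp add: l_def)
  have vN: "v \<notin> N" and NV: "N \<subseteq> V" by (auto simp: N_def nbrs_def)
  have fin: "finite N" "finite W" "finite (indsets V E)"
    using V by (auto simp: N_def finite_nbrs W_def finite_indsets)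
  have fiber: "0 \<le> sum g {I \<in> indsets V E. I - insert v N = J}" if J: "J \<in> indsets W E" for J
  proof -
    define U where "U = {u \<in> N. \<forall>j\<in>J. {u, j} \<notin> E}"
    have UN: "U \<subseteq> N" by (auto simp: U_def)
    have finU: "finite U" using fin UN finite_subset by auto
    have finJ: "finite J" using J fin finite_indset by auto
    have JW: "J \<subseteq> W" using J by (simp add: indsets_def)
    then have Jd: "J \<inter> N = {}" "v \<notin> J" "J \<subseteq> V" by (auto simp: W_def)
    have vJ: "insert v J \<in> indsets V E"
      using J v by (auto simp: indsets_def indep_def W_def N_def nbrs_def insert_commute)
    have fiber_eq: "{I \<in> indsets V E. I - insert v N = J}
        = insert (insert v J) ((\<lambda>K. J \<union> K) ` indsets U E)" (is "?L = ?R")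
    proof (intro set_eqI iffI)
      fix I assume "I \<in> ?L"
      then have I: "I \<in> indsets V E" "I - insert v N = J" by auto
      show "I \<in> ?R"
      proof (cases "v \<in> I")
        case True
        then have "I \<inter> N = {}"
          using I by (auto simp: indsets_def indep_def N_def nbrs_def)
        with I True show ?thesis by auto
      next
        case False
        have "I \<inter> N \<in> indsets U E"
          using I by (auto simp: indsets_def indep_def U_def)
        moreover have "I = J \<union> (I \<inter> N)" using I False by auto
        ultimately show ?thesis by blast
      qed
    next
      fix I assume "I \<in> ?R"
      then consider "I = insert v J" | K where "K \<in> indsets U E" "I = J \<union> K" by auto
      then show "I \<in> ?L"
      proof cases
        case 1
        then show ?thesis using vJ Jd by auto
      next
        case 2
        have "{j, u} \<notin> E" "{u, j} \<notin> E" if "j \<in> J" "u \<in> K" for j u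
          using 2 that by (auto simp: indsets_def U_def insert_commute)
        then have "J \<union> K \<in> indsets V E"
          using J 2 UN NV Jd by (auto simp: indsets_def indep_def)
        then show ?thesis using 2 Jd UN JW by (auto simp: indsets_def W_def)
      qed
    qed
    have inj: "inj_on (\<lambda>K. J \<union> K) (indsets U E)"
      using Jd UN by (intro inj_onI) (auto simp: indsets_def; blast)
    have notin: "insert v J \<notin> (\<lambda>K. J \<union> K) ` indsets U E"
      using Jd UN vN by (auto simp: indsets_def)
    have K: "g (J \<union> K) = l ^ card J * (real (card K) * l ^ card K - L * l ^ card K)"
      if "K \<in> indsets U E" for K
    proof -
      have KU: "K \<subseteq> U" "finite K" using that finU finite_indset by (auto simp: indsets_def)
      have "J \<inter> K = {}" "(J \<union> K) \<inter> N = K" "v \<notin> J \<union> K" using KU UN Jd vN by auto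
      then show ?thesis
        using KU finJ by (simp add: g_def card_Un_disjoint power_add algebra_simps)
    qed
    have J0: "g (insert v J) = l ^ card J * (l * (d - L))"
    proof -
      have "insert v J \<inter> N = {}" using Jd vN by auto
      then show ?thesis using Jd finJ by (simp add: g_def)
    qed
    have "sum g {I \<in> indsets V E. I - insert v N = J}
        = g (insert v J) + (\<Sum>K\<in>indsets U E. g (J \<union> K))"
      unfolding fiber_eq using finU notin
      by (subst sum.insert) (auto simp: finite_indsets sum.reindex[OF inj])
    \<comment> \<open>The weight of \<open>J\<close> factors out. What remains is the local bound
      for the graph on \<open>U\<close>, since l d = d / t.\<close>
    also have "\<dots> = l ^ card J * (l * (d - L) + hc_size l U E - L * hc_weight l U E)"
      by (simp add: J0 K hc_size_def hc_weight_def sum_distrib_left sum_subtractf algebra_simps)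
    also have "\<dots> \<ge> 0"
    proof -
      have "real (card (nbrs U E u)) \<le> t" if "u \<in> U" for u
      proof -
        have "card (nbrs U E u) \<le> card (nbrs N E u)"
          using UN fin by (intro card_mono) (auto simp: nbrs_def)
        then show ?thesis using codeg[of u] that UN by (auto simp: N_def)
      qed
      then have "(l + hc_weight l U E) * L \<le> d / t + hc_size l U E"
        unfolding l_def L_def using t by (intro hc_local_bound finU) auto
      then show ?thesis using l by (intro mult_nonneg_nonneg) (auto simp: l_def algebra_simps diff_divide_distrib)
    qed
    finally show ?thesis .
  qed
  have "(\<lambda>I. I - insert v N) ` indsets V E \<subseteq> indsets W E"
    by (auto simp: indsets_def indep_def W_def)
  then have "sum g (indsets V E)
      = (\<Sum>J\<in>indsets W E. sum g {I \<in> indsets V E. I - insert v N = J})"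
    using fin by (subst sum.group) (auto simp: finite_indsets)
  also have "\<dots> \<ge> 0" by (intro sum_nonneg fiber)
  finally show ?thesis
    by (simp add: g_def hc_weight_def sum_distrib_left sum_subtractf algebra_simps
        flip: N_def L_def l_def)
qed

text \<open>Sum the vertex bounds over all v. An independent set I collects d for each member, and
  its degree sum, again at most d card I; so its total is at most 2 d a, and 24 = 2 * 12.\<close>

theorem card_le_of_sparse_nbrs:
  assumes V: "finite V" and t: "t \<ge> 1" "t \<le> d"
    and deg: "\<And>v. v \<in> V \<Longrightarrow> real (card (nbrs V E v)) \<le> d"
    and codeg: "\<And>v u. v \<in> V \<Longrightarrow> u \<in> nbrs V E v \<Longrightarrow> real (card (nbrs (nbrs V E v) E u)) \<le> t"
    and a: "\<And>I. I \<in> indsets V E \<Longrightarrow> real (card I) \<le> a"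
  shows "real (card V) * ln (d / t) \<le> 24 * d * a"
proof -
  define l where "l = 1 / t"
  define Z where "Z = hc_weight l V E"
  have l: "l \<ge> 0" using t by (simp add: l_def)
  have Z: "Z \<ge> 1" unfolding Z_def using l V by (intro hc_weight_ge_1)
  have "real (card V) * (ln (d / t) / 12 * Z) = (\<Sum>v\<in>V. ln (d / t) / 12 * Z)" by simp
  also have "\<dots> \<le> (\<Sum>v\<in>V. \<Sum>I\<in>indsets V E.
      (d * of_bool (v \<in> I) + real (card (I \<inter> nbrs V E v))) * l ^ card I)"
    unfolding l_def Z_def using t V codeg by (intro sum_mono hc_vertex_bound) auto
  also have "\<dots> = (\<Sum>I\<in>indsets V E. \<Sum>v\<in>V.
      (d * of_bool (v \<in> I) + real (card (I \<inter> nbrs V E v))) * l ^ card I)"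
    by (rule sum.swap)
  also have "\<dots> \<le> (\<Sum>I\<in>indsets V E. 2 * d * a * l ^ card I)"
  proof (intro sum_mono)
    fix I assume I: "I \<in> indsets V E"
    then have IV: "I \<subseteq> V" and fI: "finite I" using V finite_indset by (auto simp: indsets_def)
    \<comment> \<open>Double counting of the adjacent pairs between I and V.\<close>
    have "(\<Sum>v\<in>V. card (I \<inter> nbrs V E v)) = (\<Sum>v\<in>V. \<Sum>i\<in>{i \<in> I. i \<in> nbrs V E v}. 1)"
      by (simp add: Int_def)
    also have "\<dots> = (\<Sum>i\<in>I. \<Sum>v\<in>{v \<in> V. i \<in> nbrs V E v}. 1)"
      by (rule sum.swap_restrict[OF V fI])
    also have "\<dots> = (\<Sum>i\<in>I. card (nbrs V E i))"
      using IV by (intro sum.cong refl) (auto simp: in_nbrs_commute nbrs_def insert_commute intro!: arg_cong[of _ _ card])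
    finally have "(\<Sum>v\<in>V. real (card (I \<inter> nbrs V E v))) = (\<Sum>i\<in>I. real (card (nbrs V E i)))"
      by (simp flip: of_nat_sum)
    also have "\<dots> \<le> (\<Sum>i\<in>I. d)" using IV by (intro sum_mono deg) auto
    finally have "(\<Sum>v\<in>V. d * of_bool (v \<in> I) + real (card (I \<inter> nbrs V E v))) \<le> 2 * d * real (card I)"
      using IV V by (simp add: sum.distrib Int_absorb1 mult.commute flip: sum_distrib_left)
    also have "\<dots> \<le> 2 * d * a" using t by (intro mult_left_mono a I) auto
    finally show "(\<Sum>v\<in>V. (d * of_bool (v \<in> I) + real (card (I \<inter> nbrs V E v))) * l ^ card I)
        \<le> 2 * d * a * l ^ card I"
      using l by (simp flip: sum_distrib_right add: mult_right_mono)
  qed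
  also have "\<dots> = 2 * d * a * Z" by (simp add: Z_def hc_weight_def sum_distrib_left)
  finally have "(real (card V) * (ln (d / t) / 12)) * Z \<le> (2 * d * a) * Z" by (simp add: mult.assoc)
  then have "real (card V) * (ln (d / t) / 12) \<le> 2 * d * a" using Z by simp
  then show ?thesis by simp
qed

section \<open>Ramsey numbers of cliques\<close>

text \<open>For empty \<open>K\<close> this is \<open>V\<close>, so cliques can be built up vertex
  by vertex from the empty one.\<close>

definition common_nbrs :: "'a set \<Rightarrow> 'a set set \<Rightarrow> 'a set \<Rightarrow> 'a set" where
  "common_nbrs V E K = {u \<in> V. \<forall>x\<in>K. u \<noteq> x \<and> {u, x} \<in> E}"

lemma common_nbrs_subset: "common_nbrs V E K \<subseteq> V"
  by (auto simp: common_nbrs_def)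

lemma nbrs_eq_common_nbrs: "nbrs V E v = common_nbrs V E {v}"
  by (auto simp: nbrs_def common_nbrs_def insert_commute)

lemma nbrs_nbrs_eq_common_nbrs: "nbrs (nbrs V E v) E u = common_nbrs V E {v, u}"
  by (auto simp: nbrs_def common_nbrs_def insert_commute)

text \<open>Used in the contrapositive: excluding s-cliques in V excludes (s - j)-cliques in the
  common neighbourhood of a j-clique.\<close>

lemma k_cliques_common_nbrs:
  assumes K: "K \<in> k_cliques j V E" and Q: "Q \<in> k_cliques i (common_nbrs V E K) E"
  shows "K \<union> Q \<in> k_cliques (j + i) V E"
proof -
  have "K \<inter> Q = {}" using Q by (auto simp: k_cliques_def nsets_def common_nbrs_def)
  have "{v, w} \<in> E" if "v \<in> K" "w \<in> Q" for v w
  proof -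
    have "{w, v} \<in> E" using Q that by (auto simp: k_cliques_def nsets_def common_nbrs_def)
    then show ?thesis by (simp add: insert_commute)
  qed
  with \<open>K \<inter> Q = {}\<close> show ?thesis
    using K Q by (auto simp: k_cliques_def nsets_def common_nbrs_def clique_Un card_Un_disjoint)
qed

lemma k_indep_sets_mono: "U \<subseteq> V \<Longrightarrow> k_indep_sets n U E \<subseteq> k_indep_sets n V E"
  by (auto simp: k_indep_sets_def nsets_def)

lemma card_indset_less:
  assumes V: "finite V" and n: "k_indep_sets n V E = {}" and I: "I \<in> indsets V E"
  shows "card I < n"
proof (rule ccontr)
  assume "\<not> card I < n"
  then obtain J where "J \<subseteq> I" "card J = n" "finite J"
    using obtain_subset_with_card_n[of n I] by (metis not_less)
  then have "J \<in> k_indep_sets n V E"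
    using I by (auto simp: k_indep_sets_def nsets_def indsets_def indep_def)
  with n show False by simp
qed

text \<open>The order of magnitude n^(s-1) / (ln n)^(s-2) of r(s,n), in a form that also makes sense for s = 1.\<close>
definition ramsey_scale :: "nat \<Rightarrow> nat \<Rightarrow> real" where
  "ramsey_scale s n = ln (real n) * (real n / ln (real n)) ^ (s - 1)"

lemma ramsey_scale_eq:
  "s \<ge> 2 \<Longrightarrow> n \<ge> 2 \<Longrightarrow> ramsey_scale s n = real n ^ (s - 1) / ln (real n) ^ (s - 2)"
  by (cases s; cases "s - 1") (auto simp: ramsey_scale_def power_divide field_simps)

lemma ln_le_self_div: "n \<ge> 2 \<Longrightarrow> 1 \<le> real n / ln (real n)"
  using ln_le_minus_one[of "real n"] by (simp add: field_simps)

lemma ln_nat_ge_half: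
  assumes "n \<ge> 2" shows "1 / 2 \<le> ln (real n)"
proof -
  have "1 / 2 \<le> ln (2::real)" using ln_le_minus_one[of "1 / 2 :: real"] by (simp add: ln_div)
  also have "\<dots> \<le> ln (real n)" using assms by simp
  finally show ?thesis .
qed

text \<open>Equivalent to ln n \<le> sqrt n, which follows from ln x \<le> x - 1 at x = sqrt n / 2
  and ln 2 < 1. It makes ln (d / t) at least half of ln n when d / t is at least n / ln n.\<close>

lemma half_ln_le_ln_div_ln:
  assumes "n \<ge> 2"
  shows "ln (real n) / 2 \<le> ln (real n / ln (real n))"
proof -
  have ln_pos: "ln (real n) > 0" using assms by simp
  have "ln (sqrt (real n)) \<le> sqrt (real n) / 2"
  proof -
    have "ln (sqrt (real n)) \<le> ln (2 * (sqrt (real n) / 2))" by simp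
    also have "\<dots> = ln 2 + ln (sqrt (real n) / 2)"
      using assms by (subst ln_mult) auto
    also have "\<dots> \<le> 1 + (sqrt (real n) / 2 - 1)"
      using assms ln_2_less_1 by (intro add_mono ln_le_minus_one) auto
    finally show ?thesis by simp
  qed
  then have "ln (real n) \<le> sqrt (real n)" using assms by (simp add: ln_sqrt)
  then have "ln (ln (real n)) \<le> ln (sqrt (real n))"
    using ln_pos by (intro ln_mono) auto
  then show ?thesis using assms ln_pos by (simp add: ln_div ln_sqrt)
qed

lemma ramsey_scale_Suc:
  "s \<ge> 1 \<Longrightarrow> ramsey_scale (Suc s) n = ramsey_scale s n * (real n / ln (real n))"
  by (cases s) (auto simp: ramsey_scale_def)

text \<open>The 1/2 is a lower bound for ln 2. The factor 2 in the bounds below compensates for it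
  and makes them at least 1.\<close>

lemma ramsey_scale_ge_half:
  assumes "n \<ge> 2"
  shows "1 / 2 \<le> ramsey_scale s n"
proof -
  have "1 / 2 * 1 \<le> ln (real n) * (real n / ln (real n)) ^ (s - 1)"
    using assms ln_nat_ge_half ln_le_self_div by (intro mult_mono one_le_power) auto
  then show ?thesis by (simp add: ramsey_scale_def)
qed

text \<open>For s \<ge> 3 the case s - 1 bounds degrees by d and the case s - 2 bounds codegrees of
  adjacent vertices by t. As d / t = 48 n / ln n, the sparse neighbourhood bound gives card V \<le>
  24 d n / (ln n / 2), whence the factor 48 per step. The induction reaches back two steps, so s = 1
  and s = 2 are both base cases.\<close>

theorem card_le_ramsey_scale:
  assumes n: "n \<ge> 2"
  shows "s \<ge> 1 \<Longrightarrow> finite V \<Longrightarrow> k_cliques s V E = {} \<Longrightarrow> k_indep_sets n V E = {} \<Longrightarrow>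
    real (card V) \<le> 2 * 48 ^ s * ramsey_scale s n"
proof (induction s arbitrary: V rule: less_induct)
  case (less s)
  have ln_pos: "ln (real n) > 0" using n by simp
  consider "s = 1" | "s = 2" | r where "s = Suc (Suc r)" "r \<ge> 1"
    using less.prems(1) by (metis One_nat_def Suc_1 le_less_Suc_eq less_Suc_eq_le not_less_eq_eq Suc_le_D)
  then show ?case
  proof cases
    case 1
    have "V = {}"
    proof (rule ccontr)
      assume "V \<noteq> {}"
      then obtain v where "v \<in> V" by auto
      then have "{v} \<in> k_cliques s V E" using 1 by (auto simp: k_cliques_def nsets_def clique_def)
      with less.prems show False by simp
    qed
    then show ?thesis using ramsey_scale_ge_half[OF n, of s] by simp
  next
    case 2
    have "V \<in> indsets V E"
    proof (rule ccontr)
      assume "V \<notin> indsets V E"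
      then obtain v w where "v \<in> V" "w \<in> V" "v \<noteq> w" "{v, w} \<in> E" by (auto simp: indsets_def indep_def)
      then have "{v, w} \<in> k_cliques s V E"
        using 2 by (auto simp: k_cliques_def nsets_def clique_def insert_commute)
      with less.prems show False by simp
    qed
    then have "card V < n" using less.prems by (intro card_indset_less)
    then have "real (card V) \<le> ramsey_scale s n" using 2 ln_pos by (simp add: ramsey_scale_def)
    also have "\<dots> \<le> 2 * 48 ^ s * ramsey_scale s n"
      using 2 ramsey_scale_ge_half[OF n, of s] by simp
    finally show ?thesis .
  next
    case 3
    define d where "d = 2 * 48 ^ Suc r * ramsey_scale (Suc r) n"
    define t where "t = 2 * 48 ^ r * ramsey_scale r n"
    define q where "q = real n / ln (real n)"
    have q: "q \<ge> 1" unfolding q_def by (rule ln_le_self_div[OF n])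
    have "1 * 1 \<le> 2 * 48 ^ r * ramsey_scale r n"
      using ramsey_scale_ge_half[OF n, of r] mult_mono[of 1 "48 ^ r" "1/2" "ramsey_scale r n"] by simp
    then have t1: "t \<ge> 1" by (simp add: t_def)
    have d: "d = 48 * q * t"
      using 3 by (simp add: d_def t_def q_def ramsey_scale_Suc)
    have "1 * t \<le> 48 * q * t" using q t1 by (intro mult_right_mono) auto
    then have td: "t \<le> d" by (simp add: d)
    \<comment> \<open>Taken with \<open>j = 1\<close> for degrees and with \<open>j = 2\<close> for
      codegrees.\<close>
    have common: "real (card (common_nbrs V E K)) \<le> 2 * 48 ^ i * ramsey_scale i n"
      if "K \<in> k_cliques j V E" "j + i = s" "i \<ge> 1" "j \<ge> 1" for K i j
    proof (intro less.IH)
      show "k_cliques i (common_nbrs V E K) E = {}"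
        using that less.prems(3) k_cliques_common_nbrs by fastforce
      show "k_indep_sets n (common_nbrs V E K) E = {}"
        using less.prems(4) k_indep_sets_mono[OF common_nbrs_subset] by blast
      show "finite (common_nbrs V E K)"
        using less.prems(2) common_nbrs_subset finite_subset by metis
    qed (use that in auto)
    have deg: "real (card (nbrs V E v)) \<le> d" if "v \<in> V" for v
      unfolding nbrs_eq_common_nbrs d_def using that 3
      by (intro common[where j = 1]) (auto simp: k_cliques_def nsets_def clique_def)
    have codeg: "real (card (nbrs (nbrs V E v) E u)) \<le> t" if "v \<in> V" "u \<in> nbrs V E v" for u v
      unfolding nbrs_nbrs_eq_common_nbrs t_def using that 3
      by (intro common[where j = 2])
        (auto simp: k_cliques_def nsets_def clique_def nbrs_def insert_commute)
    have "real (card I) \<le> real n" if "I \<in> indsets V E" for I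
      using card_indset_less[OF less.prems(2,4) that] by simp
    then have main: "real (card V) * ln (d / t) \<le> 24 * d * real n"
      using less.prems(2) t1 td deg codeg by (intro card_le_of_sparse_nbrs)
    have "ln (real n) / 2 \<le> ln q" unfolding q_def by (rule half_ln_le_ln_div_ln[OF n])
    also have "\<dots> \<le> ln (d / t)" using d t1 q by (intro ln_mono) auto
    finally have "real (card V) * (ln (real n) / 2) \<le> 24 * d * real n"
      using main by (meson mult_left_mono of_nat_0_le_iff order_trans)
    then have "real (card V) \<le> 48 * d * q"
      using ln_pos by (simp add: q_def field_simps)
    also have "\<dots> = 2 * 48 ^ s * ramsey_scale s n"
      using 3 by (simp add: d_def q_def ramsey_scale_Suc)
    finally show ?thesis .
  qed
qed

section \<open>Counting cliques in a blow-up\<close>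

lemma finite_k_cliques: "finite V \<Longrightarrow> finite (k_cliques k V E)"
  by (simp add: k_cliques_def finite_imp_finite_nsets)

text \<open>Every (j + 1)-clique is a j-clique plus one of its common neighbours; that it arises in
  several ways is ignored.\<close>

lemma card_k_cliques_le:
  assumes V: "finite V" and c0: "\<And>i. 0 \<le> c i"
    and bound: "\<And>i K. i < j \<Longrightarrow> K \<in> k_cliques i V E \<Longrightarrow> real (card (common_nbrs V E K)) \<le> c i"
  shows "real (card (k_cliques j V E)) \<le> (\<Prod>i<j. c i)"
  using bound
proof (induction j)
  case 0
  have "card (k_cliques 0 V E) \<le> card {{} :: 'a set}"
    by (intro card_mono) (auto simp: k_cliques_def nsets_def)
  then show ?case by simp
next
  case (Suc j)
  let ?S = "SIGMA K:k_cliques j V E. common_nbrs V E K"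
  have fin: "finite (k_cliques j V E)" "\<And>K. finite (common_nbrs V E K)"
    using V common_nbrs_subset finite_subset by (metis finite_k_cliques)+
  have "k_cliques (Suc j) V E \<subseteq> (\<lambda>(K, v). insert v K) ` ?S"
  proof
    fix Q assume Q: "Q \<in> k_cliques (Suc j) V E"
    then obtain v where v: "v \<in> Q" by (auto simp: k_cliques_def nsets_def card_Suc_eq)
    with Q have "Q - {v} \<in> k_cliques j V E" "v \<in> common_nbrs V E (Q - {v})"
      by (auto simp: k_cliques_def nsets_def clique_def common_nbrs_def)
    with v show "Q \<in> (\<lambda>(K, v). insert v K) ` ?S"
      by (intro image_eqI[of _ _ "(Q - {v}, v)"]) auto
  qed
  then have "card (k_cliques (Suc j) V E) \<le> card ?S"
    using fin by (intro surj_card_le) auto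
  also have "\<dots> = (\<Sum>K\<in>k_cliques j V E. card (common_nbrs V E K))"
    using fin by (simp add: card_SigmaI)
  finally have "real (card (k_cliques (Suc j) V E)) \<le> (\<Sum>K\<in>k_cliques j V E. real (card (common_nbrs V E K)))"
    by (simp flip: of_nat_sum)
  also have "\<dots> \<le> (\<Sum>K\<in>k_cliques j V E. c j)" by (intro sum_mono Suc.prems) auto
  also have "\<dots> = real (card (k_cliques j V E)) * c j" by simp
  also have "\<dots> \<le> (\<Prod>i<j. c i) * c j"
    using Suc.IH Suc.prems c0 by (intro mult_right_mono) auto
  finally show ?case by simp
qed


text \<open>The exponents m, ..., 1 add up to \<open>Suc m choose 2\<close>.\<close>

lemma prod_mult_power_diff:
  "(\<Prod>i<m. A * q ^ (m - i)) = A ^ m * (q :: real) ^ (Suc m choose 2)"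
proof (induction m)
  case (Suc m)
  have "(\<Prod>i<Suc m. A * q ^ (Suc m - i)) = A * q ^ Suc m * (\<Prod>i<m. A * q ^ (m - i))"
    by (subst prod.lessThan_Suc_shift) simp
  also have "\<dots> = A ^ Suc m * q ^ (Suc m + (Suc m choose 2))"
    by (simp only: Suc.IH power_add) simp
  finally show ?case by (simp add: numeral_2_eq_2)
qed (simp add: numeral_2_eq_2)

lemma card_k_cliques_le_ramsey_scale:
  assumes n: "n \<ge> 2" and j: "j < k" and V: "finite V"
    and "k_cliques k V E = {}" and "k_indep_sets n V E = {}"
  shows "real (card (k_cliques j V E))
    \<le> (2 * 48 ^ k * ln (real n)) ^ (k - 1) * (real n / ln (real n)) ^ (k choose 2)"
proof -
  define c where "c i = 2 * 48 ^ k * ramsey_scale (k - i) n" for i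
  have c1: "1 \<le> c i" for i
    using ramsey_scale_ge_half[OF n, of "k - i"] mult_mono[of 1 "48 ^ k" "1/2" "ramsey_scale (k - i) n"]
    by (simp add: c_def)
  then have c0: "0 \<le> c i" for i using order_trans zero_le_one by blast
  have "real (card (k_cliques j V E)) \<le> (\<Prod>i<j. c i)"
  proof (intro card_k_cliques_le V c0)
    fix i K assume i: "i < j" and K: "K \<in> k_cliques i V E"
    have "real (card (common_nbrs V E K)) \<le> 2 * 48 ^ (k - i) * ramsey_scale (k - i) n"
    proof (intro card_le_ramsey_scale n)
      show "k_cliques (k - i) (common_nbrs V E K) E = {}"
        using k_cliques_common_nbrs[OF K, of _ "k - i"] i j assms(4) by auto
      show "k_indep_sets n (common_nbrs V E K) E = {}"
        using assms(5) k_indep_sets_mono[OF common_nbrs_subset] by blast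
      show "finite (common_nbrs V E K)"
        using V common_nbrs_subset finite_subset by metis
    qed (use i j in auto)
    also have "\<dots> \<le> c i"
      unfolding c_def using ramsey_scale_ge_half[OF n, of "k - i"]
      by (intro mult_right_mono) (auto intro: power_increasing)
    finally show "real (card (common_nbrs V E K)) \<le> c i" .
  qed
  \<comment> \<open>All factors are at least 1, so the product may be extended to k - 1 factors,
    which makes the bound independent of j.\<close>
  also have "\<dots> \<le> (\<Prod>i<k - 1. c i)"
    using j c0 c1 by (intro prod_mono2) auto
  also have "\<dots> = (\<Prod>i<k - 1. (2 * 48 ^ k * ln (real n)) * (real n / ln (real n)) ^ (k - 1 - i))"
    by (intro prod.cong refl) (simp add: c_def ramsey_scale_def)
  also have "\<dots> = (2 * 48 ^ k * ln (real n)) ^ (k - 1) * (real n / ln (real n)) ^ (k choose 2)"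
    using j by (subst prod_mult_power_diff) simp
  finally show ?thesis .
qed

section \<open>Blow-ups by cliques\<close>

text \<open>\<open>f\<close> sends a vertex to the one it is a copy of. Copies of the same vertex
  are joined, so that independent sets do not grow.\<close>

definition blow_up :: "'b set \<Rightarrow> ('b \<Rightarrow> 'a) \<Rightarrow> 'a set set \<Rightarrow> 'b set set" where
  "blow_up W f E = {{x, y} | x y. x \<in> W \<and> y \<in> W \<and> x \<noteq> y \<and> (f x = f y \<or> {f x, f y} \<in> E)}"

lemma edge_blow_up_iff:
  "{x, y} \<in> blow_up W f E \<longleftrightarrow> x \<in> W \<and> y \<in> W \<and> x \<noteq> y \<and> (f x = f y \<or> {f x, f y} \<in> E)"
  unfolding blow_up_def by (auto simp: doubleton_eq_iff) (metis insert_commute)+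

lemma finite_simple_graph_blow_up: "finite W \<Longrightarrow> finite_simple_graph W (blow_up W f E)"
  by (auto simp: finite_simple_graph_def blow_up_def nsets_def)

text \<open>An independent set meets each fibre at most once, so \<open>f\<close> maps it
  injectively onto an independent set.\<close>

lemma k_indep_sets_blow_up:
  assumes "f ` W \<subseteq> V" and "k_indep_sets n V E = {}"
  shows "k_indep_sets n W (blow_up W f E) = {}"
proof (rule ccontr)
  assume "k_indep_sets n W (blow_up W f E) \<noteq> {}"
  then obtain I where I: "I \<subseteq> W" "finite I" "card I = n" "indep I (blow_up W f E)"
    by (auto simp: k_indep_sets_def nsets_def)
  then have "inj_on f I" "indep (f ` I) E"
    by (auto simp: indep_def edge_blow_up_iff inj_on_def subset_iff)
  then have "f ` I \<in> k_indep_sets n V E"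
    using I assms(1) by (auto simp: k_indep_sets_def nsets_def card_image)
  with assms(2) show False by simp
qed

text \<open>A k-clique projects to a clique S with fewer than k vertices, as k-cliques are excluded
  below. The preimage of S has at most m k vertices, hence at most (m k)^k subsets of size
  k.\<close>

lemma card_k_cliques_blow_up_le:
  assumes W: "finite W" and V: "finite V" and f: "f ` W \<subseteq> V"
    and fiber: "\<And>v. v \<in> V \<Longrightarrow> card {x \<in> W. f x = v} \<le> m"
    and free: "k_cliques k V E = {}"
  shows "card (k_cliques k W (blow_up W f E)) \<le> (m * k) ^ k * (\<Sum>j<k. card (k_cliques j V E))"
proof -
  define \<S> where "\<S> = (\<Union>j<k. k_cliques j V E)"
  define P where "P S = {x \<in> W. f x \<in> S}" for S
  have fin: "finite \<S>" "finite (P S)" for S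
    using V W by (auto simp: \<S>_def P_def finite_k_cliques)
  have P_card: "card ([P S]\<^bsup>k\<^esup>) \<le> (m * k) ^ k" if S: "S \<in> \<S>" for S
  proof -
    have SV: "S \<subseteq> V" "card S < k" "finite S"
      using S by (auto simp: \<S>_def k_cliques_def nsets_def)
    have "P S = (\<Union>v\<in>S. {x \<in> W. f x = v})" by (auto simp: P_def)
    then have "card (P S) \<le> (\<Sum>v\<in>S. card {x \<in> W. f x = v})"
      using card_UN_le SV by metis
    also have "\<dots> \<le> (\<Sum>v\<in>S. m)" using SV by (intro sum_mono fiber) auto
    also have "\<dots> \<le> m * k" using SV by simp
    finally have le: "card (P S) \<le> m * k" .
    show ?thesis
    proof (cases "k \<le> card (P S)")
      case True
      then have "card ([P S]\<^bsup>k\<^esup>) \<le> card (P S) ^ k" by (simp add: binomial_le_pow)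
      also have "\<dots> \<le> (m * k) ^ k" using le by (rule power_mono) simp
      finally show ?thesis .
    qed (simp add: binomial_eq_0)
  qed
  have "k_cliques k W (blow_up W f E) \<subseteq> (\<Union>S\<in>\<S>. [P S]\<^bsup>k\<^esup>)"
  proof
    fix X assume "X \<in> k_cliques k W (blow_up W f E)"
    then have X: "X \<subseteq> W" "finite X" "card X = k" "clique X (blow_up W f E)"
      by (auto simp: k_cliques_def nsets_def)
    then have "clique (f ` X) E" by (auto simp: clique_def edge_blow_up_iff)
    with X f have fX: "f ` X \<in> k_cliques (card (f ` X)) V E"
      by (auto simp: k_cliques_def nsets_def)
    then have "card (f ` X) \<noteq> k" using free by auto
    with X have "card (f ` X) < k" using card_image_le[of X f] by simp
    with fX have "f ` X \<in> \<S>" by (auto simp: \<S>_def)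
    moreover have "X \<in> [P (f ` X)]\<^bsup>k\<^esup>" using X by (auto simp: P_def nsets_def)
    ultimately show "X \<in> (\<Union>S\<in>\<S>. [P S]\<^bsup>k\<^esup>)" by blast
  qed
  then have "card (k_cliques k W (blow_up W f E)) \<le> card (\<Union>S\<in>\<S>. [P S]\<^bsup>k\<^esup>)"
    using fin by (intro card_mono) (auto simp: finite_imp_finite_nsets)
  also have "\<dots> \<le> (\<Sum>S\<in>\<S>. card ([P S]\<^bsup>k\<^esup>))" by (intro card_UN_le fin)
  also have "\<dots> \<le> (\<Sum>S\<in>\<S>. (m * k) ^ k)" by (intro sum_mono P_card)
  also have "\<dots> = (m * k) ^ k * card \<S>" by simp
  also have "\<dots> \<le> (m * k) ^ k * (\<Sum>j<k. card (k_cliques j V E))"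
    unfolding \<S>_def by (intro mult_left_mono card_UN_le) auto
  finally show ?thesis .
qed

text \<open>Distribute the vertices by their residue modulo \<open>card V\<close>; a residue class
  below N has at most one element for each quotient from 0 to \<open>N div card V\<close>.\<close>

lemma ex_balanced_map:
  assumes "finite V" "V \<noteq> {}"
  shows "\<exists>f. f ` {..<N} \<subseteq> V \<and> (\<forall>v\<in>V. card {x \<in> {..<N}. f x = v} \<le> N div card V + 1)"
proof -
  define r where "r = card V"
  have r: "r > 0" using assms by (simp add: r_def card_gt_0_iff)
  obtain e where e: "bij_betw e {..<r} V"
    using ex_bij_betw_nat_finite[OF assms(1)] by (auto simp: r_def atLeast0LessThan)
  have "(\<lambda>x. e (x mod r)) ` {..<N} \<subseteq> V" using e r by (auto simp: bij_betw_def)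
  moreover have "card {x \<in> {..<N}. e (x mod r) = v} \<le> N div r + 1" if "v \<in> V" for v
  proof -
    obtain j where j: "j < r" "v = e j" using e \<open>v \<in> V\<close> by (auto simp: bij_betw_def)
    have "{x \<in> {..<N}. e (x mod r) = v} \<subseteq> (\<lambda>q. q * r + j) ` {..N div r}"
    proof
      fix x assume x: "x \<in> {x \<in> {..<N}. e (x mod r) = v}"
      then have "x mod r = j" using e j r by (auto simp: bij_betw_def inj_on_def)
      then have "x = x div r * r + j" using div_mult_mod_eq[of x r] by simp
      moreover have "x div r \<le> N div r" using x by (intro div_le_mono) auto
      ultimately show "x \<in> (\<lambda>q. q * r + j) ` {..N div r}" by blast
    qed
    then have "card {x \<in> {..<N}. e (x mod r) = v} \<le> card {..N div r}"
      by (rule surj_card_le[rotated]) simp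
    then show ?thesis by simp
  qed
  ultimately show ?thesis unfolding r_def by blast
qed

section \<open>Ramsey numbers and the minimum number of cliques\<close>

lemma min_k_cliques_le:
  assumes "finite_simple_graph (V :: nat set) E" "k_indep_sets n V E = {}"
  shows "min_k_cliques (card V) k n \<le> card (k_cliques k V E)"
  unfolding min_k_cliques_def using assms by (intro Least_le) blast

lemma less_ramsey_numberE:
  assumes "N < ramsey_number k n"
  obtains V :: "nat set" and E where "finite_simple_graph V E" "card V = N"
    "k_cliques k V E = {}" "k_indep_sets n V E = {}"
  using not_less_Least[OF assms[unfolded ramsey_number_def]] by blast

lemma min_k_cliques_eq_0:
  assumes "N < ramsey_number k n"
  shows "min_k_cliques N k n = 0"
  using less_ramsey_numberE[OF assms] min_k_cliques_le by (metis card.empty le_zero_eq)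

text \<open>A graph with at most one vertex has no vertex set of size 2 or more. This keeps the
  extremal graph on r(k,n) - 1 vertices nonempty.\<close>

lemma ramsey_number_ge_2:
  assumes "k \<ge> 2" "n \<ge> 2"
  shows "ramsey_number k n \<ge> 2"
proof (rule ccontr)
  define r where "r = ramsey_number k n"
  assume "\<not> ramsey_number k n \<ge> 2"
  then have r: "r < 2" by (simp add: r_def)
  have "k_cliques k {..<r} {} \<noteq> {} \<or> k_indep_sets n {..<r} {} \<noteq> {}"
    by (rule ramsey_number_works) (auto simp: finite_simple_graph_def r_def)
  then obtain K where "K \<subseteq> {..<r}" "card K \<ge> 2"
    using assms by (auto simp: k_cliques_def k_indep_sets_def nsets_def)
  then show False using r card_mono[of "{..<r}" K] by simp
qed

text \<open>The first factor is (m k)^k with fibre size m at most 4 N / r(k,n); the second adds the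
  same clique bound over the k sizes j < k.\<close>

lemma min_k_cliques_blow_up_le:
  assumes N: "N \<ge> ramsey_number k n" and k: "k \<ge> 2" and n: "n \<ge> 2"
  shows "real (min_k_cliques N k n) \<le> (4 * k * real N / real (ramsey_number k n)) ^ k *
    (k * ((2 * 48 ^ k * ln (real n)) ^ (k - 1) * (real n / ln (real n)) ^ (k choose 2)))"
proof -
  define r where "r = ramsey_number k n"
  define B where "B = (2 * 48 ^ k * ln (real n)) ^ (k - 1) * (real n / ln (real n)) ^ (k choose 2)"
  have r: "r \<ge> 2" unfolding r_def by (rule ramsey_number_ge_2[OF k n])
  then obtain V :: "nat set" and E where V: "finite_simple_graph V E" "card V = r - 1"
    "k_cliques k V E = {}" "k_indep_sets n V E = {}"
    using less_ramsey_numberE[of "r - 1" k n] by (auto simp: r_def)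
  have fin: "finite V" "V \<noteq> {}" using V r by (auto simp: finite_simple_graph_def)
  define m where "m = N div card V + 1"
  obtain f where f: "f ` {..<N} \<subseteq> V" "\<And>v. v \<in> V \<Longrightarrow> card {x \<in> {..<N}. f x = v} \<le> m"
    using ex_balanced_map[OF fin, of N] by (auto simp: m_def)
  have "min_k_cliques N k n \<le> card (k_cliques k {..<N} (blow_up {..<N} f E))"
    using min_k_cliques_le[OF finite_simple_graph_blow_up k_indep_sets_blow_up[OF f(1) V(4)]] by simp
  also have "\<dots> \<le> (m * k) ^ k * (\<Sum>j<k. card (k_cliques j V E))"
    by (intro card_k_cliques_blow_up_le fin f V(3)) auto
  finally have "real (min_k_cliques N k n) \<le> real ((m * k) ^ k * (\<Sum>j<k. card (k_cliques j V E)))"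
    by (simp only: of_nat_le_iff)
  also have "\<dots> = (real m * real k) ^ k * (\<Sum>j<k. real (card (k_cliques j V E)))" by simp
  also have "\<dots> \<le> (4 * k * real N / r) ^ k * (\<Sum>j<k. B)"
  proof (intro mult_mono power_mono sum_mono)
    have "real m \<le> real N / real (r - 1) + 1"
      unfolding m_def V(2) of_nat_add of_nat_1 by (intro add_right_mono of_nat_div_le_of_nat)
    \<comment> \<open>Here r - 1 \<ge> r / 2 because r \<ge> 2, and 1 \<le> N / r because N \<ge>
      r.\<close>
    also have "\<dots> \<le> real N / (real r / 2) + real N / real r"
      using r N by (intro add_mono divide_left_mono) (auto simp: r_def)
    also have "\<dots> \<le> 4 * real N / real r" by (simp add: field_simps divide_right_mono)
    finally have "real m * k \<le> 4 * real N / real r * k" by (rule mult_right_mono) simp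
    then show "real m * real k \<le> 4 * k * real N / r" by (simp add: mult_ac)
    show "real (card (k_cliques j V E)) \<le> B" if "j \<in> {..<k}" for j
      unfolding B_def using that by (intro card_k_cliques_le_ramsey_scale n fin V) auto
  qed (auto intro: sum_nonneg)
  finally show ?thesis by (simp add: B_def r_def)
qed

section \<open>Uniform constants and conclusion\<close>

text \<open>For the finitely many n below the threshold, \<open>T\<close> bounds the scale, so a
  constant of at most 1 / (1 + T) brings the left side below 1, while r(k,n) \<ge> 2.\<close>

lemma ramsey_number_lower_uniform:
  assumes "b1 > 0" "k \<ge> 2"
    and "\<forall>\<^sub>F n in sequentially. b1 * ramsey_scale k n \<le> real (ramsey_number k n)"
  shows "\<exists>b>0. \<forall>n\<ge>2. b * ramsey_scale k n \<le> real (ramsey_number k n)"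
proof -
  obtain n0 where n0: "\<And>n. n \<ge> n0 \<Longrightarrow> b1 * ramsey_scale k n \<le> real (ramsey_number k n)"
    using assms(3) by (auto simp: eventually_sequentially)
  define T where "T = (\<Sum>n\<in>{2..<n0}. ramsey_scale k n)"
  have pos: "ramsey_scale k n > 0" if "n \<ge> 2" for n
    using ramsey_scale_ge_half[OF that, of k] by simp
  have T0: "T \<ge> 0" unfolding T_def using pos by (intro sum_nonneg) (auto intro: less_imp_le)
  define b where "b = min b1 (1 / (1 + T))"
  have "b > 0" using assms T0 by (simp add: b_def)
  moreover have "b * ramsey_scale k n \<le> real (ramsey_number k n)" if n: "n \<ge> 2" for n
  proof (cases "n \<ge> n0")
    case True
    have "b * ramsey_scale k n \<le> b1 * ramsey_scale k n"
      using pos[OF n] by (intro mult_right_mono) (auto simp: b_def)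
    with n0[OF True] show ?thesis by simp
  next
    case False
    have "ramsey_scale k n \<le> T"
      unfolding T_def using n False pos by (intro member_le_sum) (auto intro: less_imp_le)
    then have "b * ramsey_scale k n \<le> 1 / (1 + T) * (1 + T)"
      using T0 pos[OF n] \<open>b > 0\<close> by (intro mult_mono) (auto simp: b_def)
    also have "\<dots> \<le> real (ramsey_number k n)"
      using T0 ramsey_number_ge_2[OF assms(2) n] by simp
    finally show ?thesis .
  qed
  ultimately show ?thesis by blast
qed

theorem theorem1p5:
  fixes k :: nat and b1 b2 :: real
  assumes "k \<ge> 5" and "b1 > 0" and "b2 > 0"
    and "\<forall>\<^sub>F n in sequentially.
      b1 * real n ^ (k - 1) / ln (real n) ^ (k - 2) \<le> real (ramsey_number k n) \<and>
      real (ramsey_number k n) \<le> b2 * real n ^ (k - 1) / ln (real n) ^ (k - 2)"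
  shows "\<exists>a1 a2 :: real. a1 > 0 \<and> a2 > 0 \<and>
    (\<forall>n N :: nat. n \<ge> 2 \<and> N \<ge> 1 \<longrightarrow>
      (real N \<le> a1 * real n ^ (k - 1) / ln (real n) ^ (k - 2) \<longrightarrow> min_k_cliques N k n = 0) \<and>
      (real N \<ge> a1 * real n ^ (k - 1) / ln (real n) ^ (k - 2) \<longrightarrow>
        real (min_k_cliques N k n) \<le>
          a2 * real (N choose k) * (ln (real n) / real n) ^ (k choose 2) * (1 / ln (real n))))"
proof -
  have k: "k \<ge> 2" using assms by simp
  have "\<forall>\<^sub>F n in sequentially. b1 * ramsey_scale k n \<le> real (ramsey_number k n)"
    using assms(4) eventually_ge_at_top[of 2] by eventually_elim (use k in \<open>simp add: ramsey_scale_eq\<close>)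
  then obtain b where b: "b > 0" "\<And>n. n \<ge> 2 \<Longrightarrow> b * ramsey_scale k n \<le> real (ramsey_number k n)"
    using ramsey_number_lower_uniform[OF assms(2) k] by blast
  define C :: real where "C = 2 * 48 ^ k"
  \<comment> \<open>The factors come from the fibre sizes, the number of clique sizes, the k - 1
    neighbourhood bounds, and N^k \<le> k^k (N choose k).\<close>
  define a2 where "a2 = (4 * k / b) ^ k * k * C ^ (k - 1) * real k ^ k"
  have C: "C > 0" by (simp add: C_def)
  have a2: "a2 > 0" using b k C by (simp add: a2_def)
  have vanish: "min_k_cliques N k n = 0"
    if n: "n \<ge> 2" and N: "real N \<le> b / 2 * ramsey_scale k n" for n N
  proof (rule min_k_cliques_eq_0)
    \<comment> \<open>Halving \<open>b\<close> gives the strict inequality needed to stay below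
      r(k,n).\<close>
    have "b / 2 * ramsey_scale k n < b * ramsey_scale k n"
      using b ramsey_scale_ge_half[OF n, of k] by (intro mult_strict_right_mono) auto
    with N b(2)[OF n] have "real N < real (ramsey_number k n)" by linarith
    then show "N < ramsey_number k n" by simp
  qed
  have bound: "real (min_k_cliques N k n)
      \<le> a2 * real (N choose k) * (ln (real n) / real n) ^ (k choose 2) * (1 / ln (real n))"
    (is "_ \<le> ?rhs") if n: "n \<ge> 2" for n N
  proof -
    define x where "x = ln (real n)"
    define q where "q = real n / x"
    define c where "c = k choose 2"
    have x: "x > 0" using n by (simp add: x_def)
    have q: "q > 0" using n x by (simp add: q_def)
    have rhs: "?rhs = a2 * real (N choose k) / (q ^ c * x)"
      using x n by (simp add: q_def c_def x_def power_divide)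
    have rhs0: "?rhs \<ge> 0" unfolding rhs using a2 x q by simp
    \<comment> \<open>For N < k both sides vanish; the comparison of N^k with the binomial
      coefficient needs N \<ge> k.\<close>
    consider "N < ramsey_number k n" | "N < k" | "N \<ge> ramsey_number k n" "N \<ge> k" by linarith
    then show ?thesis
    proof cases
      case 1
      then show ?thesis using rhs0 by (simp add: min_k_cliques_eq_0)
    next
      case 2
      obtain V :: "nat set" and E where V: "finite_simple_graph V E" "card V = N"
        "card (k_cliques k V E) = min_k_cliques N k n"
        using min_k_cliques_attained[OF n, of N k] by blast
      have "card (k_cliques k V E) \<le> card ([V]\<^bsup>k\<^esup>)"
        using V
        by (intro card_mono)
          (auto simp: k_cliques_def finite_simple_graph_def finite_imp_finite_nsets)
      with V 2 have "min_k_cliques N k n = 0" by (simp add: binomial_eq_0)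
      with rhs0 show ?thesis by simp
    next
      case 3
      have scale: "ramsey_scale k n = x * q ^ (k - 1)"
        by (simp add: ramsey_scale_def x_def q_def)
      have "even (k * (k - 1))" by (cases k) auto
      then have "2 * c = k * (k - 1)" unfolding c_def choose_two by (rule dvd_mult_div_cancel)
      then have "(k - 1) * k = c + c" by (simp add: mult.commute)
      \<comment> \<open>The k-th power of the scale is x^k q^(2c). Dividing the clique bound, of
        order x^(k-1) q^c, by it leaves 1 / (x q^c), which is the claimed saving.\<close>
      then have qq: "(q ^ (k - 1)) ^ k = q ^ c * q ^ c"
        by (simp only: flip: power_mult power_add)
      have kk: "x ^ k = x * x ^ (k - 1)" using k by (simp flip: power_Suc)
      have "real (min_k_cliques N k n)
          \<le> (4 * k * real N / real (ramsey_number k n)) ^ k * (k * ((C * x) ^ (k - 1) * q ^ c))"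
        using min_k_cliques_blow_up_le[OF 3(1) k n] by (simp add: C_def x_def q_def c_def)
      also have "\<dots> \<le> (4 * k * real N / (b * (x * q ^ (k - 1)))) ^ k * (k * ((C * x) ^ (k - 1) * q ^ c))"
        using b(2)[OF n] b(1) x q C
        by (intro mult_right_mono power_mono divide_left_mono)
          (auto simp: scale intro!: mult_pos_pos order_less_le_trans[of 0 "b * (x * q ^ (k - 1))" "real (ramsey_number k n)"])
      also have "\<dots> = (4 * k / b) ^ k * k * C ^ (k - 1) * real N ^ k / (q ^ c * x)"
        using x q b by (simp add: power_mult_distrib power_divide qq[unfolded One_nat_def] kk mult_ac)
      also have "\<dots> \<le> (4 * k / b) ^ k * k * C ^ (k - 1) * (real k ^ k * real (N choose k)) / (q ^ c * x)"
      proof (intro divide_right_mono mult_left_mono)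
        have "(real N / real k) ^ k \<le> real (N choose k)"
          by (rule binomial_ge_n_over_k_pow_k[OF 3(2)])
        then show "real N ^ k \<le> real k ^ k * real (N choose k)"
          using k by (simp add: power_divide field_simps)
      qed (use x q b C in auto)
      finally show ?thesis unfolding rhs by (simp add: a2_def mult.assoc)
    qed
  qed
  have "b / 2 > 0 \<and> a2 > 0 \<and> (\<forall>n N :: nat. n \<ge> 2 \<and> N \<ge> 1 \<longrightarrow>
      (real N \<le> b / 2 * real n ^ (k - 1) / ln (real n) ^ (k - 2) \<longrightarrow> min_k_cliques N k n = 0) \<and>
      (real N \<ge> b / 2 * real n ^ (k - 1) / ln (real n) ^ (k - 2) \<longrightarrow>
        real (min_k_cliques N k n) \<le>
          a2 * real (N choose k) * (ln (real n) / real n) ^ (k choose 2) * (1 / ln (real n))))"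
    using b(1) a2 bound vanish k by (auto simp: ramsey_scale_eq)
  then show ?thesis by blast
qed

end
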